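(* For all integers $m\ge 2$ and $n\ge 2$, the independence polynomial of the tree $G_{m,n}=(W_m;b_2)\ominus(W_n;v_2)$ is unimodal.
   Context: All graphs are finite, undirected, without loops or multiple edges. A stable set of a graph $G$ is a set of pairwise non-adjacent vertices; $\alpha(G)$ is the maximum size of a stable set. If $s_k$ is the number of stable sets of size $k$ in $G$ (with $s_0=1$), the independence polynomial of $G$ is $I(G;x)=\sum_{k=0}^{\alpha(G)}s_kx^k$. A polynomial with non-negative real coefficients $a_0,\dots,a_N$ is unimodal if there is $k\in\{0,\dots,N\}$ with $a_0\le\dots\le a_k\ge a_{k+1}\ge\dots\ge a_N$. For disjoint graphs $G_1,G_2$ and vertices $v_i\in V(G_i)$, the edge-join $(G_1;v_1)\ominus(G_2;v_2)$ is the graph obtained from the disjoint union of $G_1$ and $G_2$ by adding the edge $v_1v_2$. The centipede $W_n$ ($n\ge 1$) is the tree with vertex set $\{a_1,\dots,a_n\}\cup\{b_1,\dots,b_n\}$ ($2n$ distinct vertices) and edge set $\{a_ib_i:1\le i\le n\}\cup\{b_ib_{i+1}:1\le i\le n-1\}$. In $G_{m,n}$, the copy of $W_m$ has vertices $a_i,b_i$ ($1\le i\le m$), with edge set $\{a_ib_i:1\le i\le m\}\cup\{b_ib_{i+1}:1\le i\le m-1\}$, and the (disjoint) copy of $W_n$ has vertices $u_i$ (in the role of $a_i$) and $v_i$ (in the role of $b_i$), $1\le i\le n$. Thus $G_{m,n}$ has edges $a_ib_i$ ($1\le i\le m$), $b_ib_{i+1}$ ($1\le i\le m-1$), $u_iv_i$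 ($1\le i\le n$), $v_iv_{i+1}$ ($1\le i\le n-1$), and $b_2v_2$. *)

theory Defs
  imports
    "Graph_Theory.Pair_Digraph"
    "HOL-Computational_Algebra.Polynomial"
begin

text \<open>
  Finite simple graphs are the \<open>pair_graph\<close>s of \<open>Graph_Theory\<close>: finite vertex set, and a
  symmetric and irreflexive set of arcs, so that each edge \<open>xy\<close> is given by the two arcs
  \<open>(x, y)\<close> and \<open>(y, x)\<close>.
\<close>

definition stable_set :: "'a pair_pre_digraph \<Rightarrow> 'a set \<Rightarrow> bool" where
  "stable_set G S \<longleftrightarrow> S \<subseteq> pverts G \<and> pairwise (\<lambda>x y. (x, y) \<notin> parcs G) S"

definition stability_number :: "'a pair_pre_digraph \<Rightarrow> nat" where
  "stability_number G = Max (card ` {S. stable_set G S})"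

definition num_stable_sets :: "'a pair_pre_digraph \<Rightarrow> nat \<Rightarrow> nat" where
  "num_stable_sets G k = card {S. stable_set G S \<and> card S = k}"

definition independence_poly :: "'a pair_pre_digraph \<Rightarrow> real poly" where
  "independence_poly G =
     (\<Sum>k\<le>stability_number G. monom (of_nat (num_stable_sets G k)) k)"

definition unimodal :: "real poly \<Rightarrow> bool" where
  "unimodal p \<longleftrightarrow>
     (\<forall>i. coeff p i \<ge> 0) \<and>
     (\<exists>k\<le>degree p.
        (\<forall>i<k. coeff p i \<le> coeff p (Suc i)) \<and>
        (\<forall>i. k \<le> i \<and> i < degree p \<longrightarrow> coeff p i \<ge> coeff p (Suc i)))"

text \<open>
  The two graphs are made disjoint by the injections into the sum type.
\<close>

definition edge_join ::
  "'a pair_pre_digraph \<Rightarrow> 'a \<Rightarrow> 'b pair_pre_digraph \<Rightarrow> 'b \<Rightarrow> ('a + 'b) pair_pre_digraph" where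
  "edge_join G\<^sub>1 v\<^sub>1 G\<^sub>2 v\<^sub>2 =
     \<lparr> pverts = pverts G\<^sub>1 <+> pverts G\<^sub>2,
       parcs = map_prod Inl Inl ` parcs G\<^sub>1 \<union> map_prod Inr Inr ` parcs G\<^sub>2
         \<union> {(Inl v\<^sub>1, Inr v\<^sub>2), (Inr v\<^sub>2, Inl v\<^sub>1)} \<rparr>"

datatype centipede_vertex = A nat | B nat

definition centipede_edges :: "nat \<Rightarrow> (centipede_vertex \<times> centipede_vertex) set" where
  "centipede_edges n =
     {(A i, B i) | i. 1 \<le> i \<and> i \<le> n} \<union> {(B i, B (i + 1)) | i. 1 \<le> i \<and> i + 1 \<le> n}"

definition centipede :: "nat \<Rightarrow> centipede_vertex pair_pre_digraph" where
  "centipede n =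
     \<lparr> pverts = A ` {1..n} \<union> B ` {1..n},
       parcs = centipede_edges n \<union> (centipede_edges n)\<inverse> \<rparr>"

text \<open>
  \<open>Inl\<close> tags the copy of \<open>W\<^sub>m\<close> and \<open>Inr\<close> the copy of \<open>W\<^sub>n\<close>: \<open>a\<^sub>i\<close>, \<open>b\<^sub>i\<close>, \<open>u\<^sub>i\<close>, \<open>v\<^sub>i\<close> are
  \<open>Inl (A i)\<close>, \<open>Inl (B i)\<close>, \<open>Inr (A i)\<close>, \<open>Inr (B i)\<close>.
\<close>

definition joined_centipedes ::
  "nat \<Rightarrow> nat \<Rightarrow> (centipede_vertex + centipede_vertex) pair_pre_digraph" where
  "joined_centipedes m n = edge_join (centipede m) (B 2) (centipede n) (B 2)"

lemma pair_graph_centipede: "pair_graph (centipede n)"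
proof
  have *: "parcs (centipede n) \<subseteq> pverts (centipede n) \<times> pverts (centipede n)"
    by (auto simp: centipede_def centipede_edges_def)
  show fin: "finite (pverts (centipede n))"
    by (simp add: centipede_def)
  show "finite (parcs (centipede n))"
    using * fin by (meson finite_SigmaI finite_subset)
  show "symmetric (with_proj (centipede n))"
    by (auto simp: symmetric_def sym_def arcs_ends_conv centipede_def)
qed (auto simp: centipede_def centipede_edges_def)

lemma pair_graph_edge_join:
  assumes "pair_graph G\<^sub>1" "pair_graph G\<^sub>2" "v\<^sub>1 \<in> pverts G\<^sub>1" "v\<^sub>2 \<in> pverts G\<^sub>2"
  shows "pair_graph (edge_join G\<^sub>1 v\<^sub>1 G\<^sub>2 v\<^sub>2)"
proof -
  interpret G1: pair_graph G\<^sub>1 by fact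
  interpret G2: pair_graph G\<^sub>2 by fact
  have sym: "(y, x) \<in> parcs G\<^sub>1" if "(x, y) \<in> parcs G\<^sub>1" for x y
    using that G1.arcs_symmetric by simp
  have sym': "(y, x) \<in> parcs G\<^sub>2" if "(x, y) \<in> parcs G\<^sub>2" for x y
    using that G2.arcs_symmetric by simp
  show ?thesis
  proof
    have "sym (parcs (edge_join G\<^sub>1 v\<^sub>1 G\<^sub>2 v\<^sub>2))"
      by (rule symI) (force simp: edge_join_def dest: sym sym')
    then show "symmetric (with_proj (edge_join G\<^sub>1 v\<^sub>1 G\<^sub>2 v\<^sub>2))"
      by (simp add: symmetric_def)
  qed (use assms in \<open>auto simp: edge_join_def dest: G1.in_arcsD1 G1.in_arcsD2 G2.in_arcsD1 G2.in_arcsD2 G1.no_loops G2.no_loops\<close>)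
qed

lemma pair_graph_joined_centipedes:
  assumes "m \<ge> 2" "n \<ge> 2"
  shows "pair_graph (joined_centipedes m n)"
  unfolding joined_centipedes_def
  by (intro pair_graph_edge_join pair_graph_centipede)
    (use assms in \<open>auto simp: centipede_def\<close>)

end

theory Submission
  imports Defs "HOL-Computational_Algebra.Fundamental_Theorem_Algebra"
begin

text \<open>
  The independence polynomial of \<open>G\<^bsub>m,n\<^esub>\<close> turns out to have only real roots. Its coefficients
  are non-negative, so the roots are non-positive and the polynomial is a positive constant times
  a product of factors \<open>x + c\<close> with \<open>c \<ge> 0\<close>. Multiplication by such a factor preserves
  log-concavity (\<open>coeffs_log_concave_mult_linear\<close>), and a log-concave sequence without internal
  zeros is unimodal (\<open>unimodal_if_log_concave\<close>).

  To see that no root \<open>z\<close> is non-real, shorten the copy of \<open>W\<^sub>n\<close>. Let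
  \<open>F\<^sub>k = I(G\<^bsub>m,k\<^esub>; z)\<close> for \<open>k \<ge> 2\<close>, and let \<open>F\<^sub>1\<close> be the value for the disjoint union of \<open>W\<^sub>m\<close> and
  one edge. Splitting the stable sets by whether they contain the last spine vertex \<open>v\<^sub>k\<close> gives
  \<open>F\<^sub>k = (1 + z) F\<^bsub>k-1\<^esub> + z (1 + z) F\<^bsub>k-2\<^esub>\<close> for \<open>k \<ge> 3\<close>, and the values \<open>w\<^sub>k\<close> of the polynomials of the
  centipedes \<open>W\<^sub>k\<close> satisfy the same recurrence. In terms of the ratios \<open>r\<^sub>k = F\<^sub>k / F\<^bsub>k-1\<^esub>\<close> it reads
  \<open>r\<^sub>k = (1 + z) + z (1 + z) / r\<^bsub>k-1\<^esub>\<close>. The right-hand side maps the convex cone spanned by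
  \<open>1 + z\<close> and \<open>z\<close> to itself, because dividing \<open>z (1 + z)\<close> by an element of the cone amounts, up to
  positive factors, to interchanging its two generators (\<open>ratio_cone_step\<close>). For non-real \<open>z\<close> the
  cone, without its apex, omits \<open>0\<close>. Hence no \<open>F\<^sub>k\<close> vanishes if \<open>F\<^sub>0\<close> does not and
  the first ratio lies in the cone.

  The two copies interact only in this starting value. Extending the recurrence backwards to \<open>k = 0\<close>
  gives \<open>F\<^sub>0 = (1 + 2z) (1 + z) w\<^bsub>m-2\<^esub>\<close>, because removing from \<open>G\<^bsub>m,2\<^esub>\<close> the vertex \<open>v\<^sub>2\<close> and its neighbours, \<open>b\<^sub>2\<close> among
  them, leaves the isolated vertices \<open>u\<^sub>1\<close> and \<open>a\<^sub>2\<close>, the edge \<open>a\<^sub>1 b\<^sub>1\<close> and a copy of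
  \<open>W\<^bsub>m-2\<^esub>\<close>. As \<open>F\<^sub>1 = (1 + 2z) w\<^sub>m\<close>, the factor \<open>1 + 2z\<close> cancels, and
  \<open>F\<^sub>1 / F\<^sub>0 = w\<^bsub>m-1\<^esub> / w\<^bsub>m-2\<^esub> + z\<close> lies in the cone because the ratio of centipede values does
  (\<open>joined_val_nonzero\<close>).
\<close>

section \<open>Real-rooted polynomials are unimodal\<close>

text \<open>
  For non-negative coefficients this says that they are log-concave without internal zeros. The
  case \<open>j = i + 1\<close> alone would admit \<open>1 + x\<^sup>3\<close>, which is not unimodal.
\<close>

definition coeffs_log_concave :: "real poly \<Rightarrow> bool" where
  "coeffs_log_concave p \<longleftrightarrow>
     (\<forall>i j. i \<le> j \<longrightarrow> coeff p i * coeff p (Suc j) \<le> coeff p (Suc i) * coeff p j)"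

text \<open>
  The new coefficients are \<open>b\<^sub>i = a\<^bsub>i-1\<^esub> + c a\<^sub>i\<close>. Both sides of the inequality for \<open>b\<close> are
  polynomials of degree two in \<open>c\<close>, and the inequality holds separately for each power of \<open>c\<close>.
\<close>

lemma coeffs_log_concave_mult_linear:
  assumes lc: "coeffs_log_concave p" and nonneg: "\<And>i. coeff p i \<ge> 0" and c: "c \<ge> 0"
  shows "coeffs_log_concave ([:c, 1:] * p)"
proof -
  define b where "b = coeff ([:c, 1:] * p)"
  let ?a = "coeff p"
  have b0: "b 0 = c * ?a 0" and bS: "b (Suc i) = ?a i + c * ?a (Suc i)" for i
    by (simp_all add: b_def)
  have tp: "?a i * ?a (Suc j) \<le> ?a (Suc i) * ?a j" if "i \<le> j" for i j
    using lc that by (auto simp: coeffs_log_concave_def)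
  have "b i * b (Suc j) \<le> b (Suc i) * b j" if ij: "i \<le> j" for i j
  proof (cases i)
    case i0: 0
    show ?thesis
    proof (cases j)
      case 0
      then show ?thesis using i0 by simp
    next
      case (Suc j')
      have "?a 0 * ?a (Suc j) \<le> ?a 1 * ?a j" "?a 0 * ?a j \<le> ?a 1 * ?a j'"
        using tp[of 0 j] tp[of 0 j'] Suc by simp_all
      then have "c * c * (?a 0 * ?a (Suc j)) \<le> c * c * (?a 1 * ?a j)"
        "c * (?a 0 * ?a j) \<le> c * (?a 0 * ?a j + ?a 1 * ?a j')" "0 \<le> ?a 0 * ?a j'"
        using c nonneg by (auto intro!: mult_left_mono)
      then show ?thesis using i0 Suc by (simp add: b0 bS algebra_simps)
    qed
  next
    case (Suc i')
    with ij obtain j' where j': "j = Suc j'" and le: "i' \<le> j'" by (cases j) auto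
    have const: "?a i' * ?a j \<le> ?a i * ?a j'"
      using tp[OF le] Suc j' by simp
    have quad: "?a i * ?a (Suc j) \<le> ?a (Suc i) * ?a j"
      by (rule tp[OF ij])
    (* The coefficient of c also has the term a_i * a_j on both sides, which cancels. *)
    have lin: "?a i' * ?a (Suc j) \<le> ?a (Suc i) * ?a j'"
    proof (cases "i = j")
      case True
      then show ?thesis using Suc j' by simp
    next
      case False
      with ij j' have "i \<le> j'" by simp
      have "?a i' * ?a (Suc j) \<le> ?a i * ?a j" using tp[of i' j] le Suc j' by simp
      also have "\<dots> \<le> ?a (Suc i) * ?a j'" using tp[OF \<open>i \<le> j'\<close>] j' by simp
      finally show ?thesis .
    qed
    have "c * (?a i' * ?a (Suc j)) \<le> c * (?a (Suc i) * ?a j')"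
      "c * c * (?a i * ?a (Suc j)) \<le> c * c * (?a (Suc i) * ?a j)"
      using lin quad c by (auto intro!: mult_left_mono)
    with const show ?thesis using Suc j' by (simp add: bS algebra_simps)
  qed
  then show ?thesis by (simp add: coeffs_log_concave_def b_def)
qed

text \<open>
  A maximal coefficient \<open>a\<^sub>k\<close> serves as the mode: comparing the pair \<open>a\<^sub>i\<close>, \<open>a\<^bsub>i+1\<^esub>\<close> with the pair
  at the mode gives monotonicity on either side, since \<open>a\<^sub>k > 0\<close> can be cancelled.
\<close>

lemma unimodal_if_log_concave:
  assumes lc: "coeffs_log_concave p" and nonneg: "\<And>i. coeff p i \<ge> 0" and "p \<noteq> 0"
  shows "unimodal p"
proof -
  let ?a = "coeff p"
  have "finite (?a ` {..degree p})" "?a ` {..degree p} \<noteq> {}" by auto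
  from Max_in[OF this] obtain k where k: "k \<le> degree p" "?a k = Max (?a ` {..degree p})"
    by (metis (mono_tags, lifting) atMost_iff imageE)
  have max: "?a i \<le> ?a k" for i
  proof (cases "i \<le> degree p")
    case True
    then show ?thesis by (simp add: k(2))
  next
    case False
    then show ?thesis using nonneg by (simp add: coeff_eq_0)
  qed
  have "?a (degree p) > 0" using nonneg[of "degree p"] \<open>p \<noteq> 0\<close> by (simp add: order_less_le)
  with max[of "degree p"] have pos: "?a k > 0" by simp
  have tp: "?a i * ?a (Suc j) \<le> ?a (Suc i) * ?a j" if "i \<le> j" for i j
    using lc that by (auto simp: coeffs_log_concave_def)
  have up: "?a i \<le> ?a (Suc i)" if "i < k" for i
  proof -
    from that obtain k' where k': "k = Suc k'" "i \<le> k'" by (cases k) auto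
    have "?a i * ?a k \<le> ?a (Suc i) * ?a k'" using tp k' by simp
    also have "\<dots> \<le> ?a (Suc i) * ?a k" by (intro mult_left_mono max nonneg)
    finally show ?thesis using pos by simp
  qed
  have down: "?a (Suc i) \<le> ?a i" if "k \<le> i" for i
  proof -
    have "?a k * ?a (Suc i) \<le> ?a (Suc k) * ?a i" using tp that by simp
    also have "\<dots> \<le> ?a k * ?a i" by (intro mult_right_mono max nonneg)
    finally show ?thesis using pos by simp
  qed
  show ?thesis unfolding unimodal_def using nonneg k(1) up down by blast
qed

lemma poly_map_poly_of_real:
  "poly (map_poly of_real p) (of_real x :: complex) = of_real (poly p x)"
  by (induction p) (auto simp: map_poly_pCons)

text \<open>
  Linear factors are split off one at a time. The hypothesis concerns complex roots, so the
  fundamental theorem of algebra supplies the next one, and it is inherited by the quotient.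
\<close>

lemma log_concave_if_roots_nonpos:
  assumes "lead_coeff p > 0"
    and "\<And>z. poly (map_poly complex_of_real p) z = 0 \<Longrightarrow> z \<in> \<real> \<and> Re z \<le> 0"
  shows "(\<forall>i. coeff p i \<ge> 0) \<and> coeffs_log_concave p"
  using assms
proof (induction "degree p" arbitrary: p)
  case 0
  then obtain a where "p = [:a:]" by (metis degree_eq_zeroE)
  with 0 show ?case by (auto simp: coeffs_log_concave_def coeff_pCons split: nat.splits)
next
  case (Suc d)
  let ?C = "map_poly complex_of_real"
  have "degree (?C p) = Suc d" using Suc.hyps(2) by (simp add: degree_map_poly)
  then have "\<not> constant (poly (?C p))" by (simp add: constant_degree)
  then obtain z where z: "poly (?C p) z = 0" using fundamental_theorem_of_algebra by blast
  define r where "r = Re z"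
  have r: "z = of_real r" "r \<le> 0"
    using Suc.prems(2)[OF z] by (auto simp: r_def)
  have "poly p r = 0" using z r(1) by (metis of_real_eq_0_iff poly_map_poly_of_real)
  then obtain q where q: "p = [:-r, 1:] * q" by (metis dvdE poly_eq_0_iff_dvd)
  have "q \<noteq> 0" using q Suc.prems(1) by auto
  then have deg: "degree p = Suc (degree q)" unfolding q by (subst degree_mult_eq) auto
  have lead: "lead_coeff q > 0" using Suc.prems(1) unfolding q lead_coeff_mult by simp
  have "?C p = ?C [:-r, 1:] * ?C q"
    unfolding q by (simp only: poly_eq_iff coeff_map_poly coeff_mult of_real_0 of_real_sum of_real_mult) simp
  then have "poly (?C p) w = 0" if "poly (?C q) w = 0" for w using that by simp
  then have IH: "(\<forall>i. coeff q i \<ge> 0) \<and> coeffs_log_concave q"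
    using Suc.hyps deg lead Suc.prems(2) by auto
  have "coeff p i \<ge> 0" for i
    unfolding q using IH r(2)
    by (cases i) (auto simp: mult_nonpos_nonneg intro: order_trans[of _ 0])
  moreover have "coeffs_log_concave p"
    unfolding q using IH r(2) by (intro coeffs_log_concave_mult_linear) auto
  ultimately show ?case by blast
qed

text \<open>
  A polynomial with non-negative coefficients is positive on the positive axis, so its real roots
  are automatically non-positive.
\<close>

lemma unimodal_if_real_rooted:
  assumes nonneg: "\<And>i. coeff p i \<ge> 0" and "p \<noteq> 0"
    and real: "\<And>z. poly (map_poly complex_of_real p) z = 0 \<Longrightarrow> z \<in> \<real>"
  shows "unimodal p"
proof (rule unimodal_if_log_concave)
  have lead: "lead_coeff p > 0"
    using nonneg[of "degree p"] \<open>p \<noteq> 0\<close> by (simp add: order_less_le)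
  have pos: "poly p r > 0" if "r > 0" for r
    unfolding poly_altdef
    by (rule sum_pos2[of _ "degree p"]) (use that lead nonneg in auto)
  have "Re z \<le> 0" if "poly (map_poly complex_of_real p) z = 0" for z
  proof -
    have "z = of_real (Re z)" using real[OF that] by simp
    then have "poly p (Re z) = 0" using that by (metis of_real_eq_0_iff poly_map_poly_of_real)
    with pos[of "Re z"] show ?thesis by fastforce
  qed
  with log_concave_if_roots_nonpos[OF lead] real show "coeffs_log_concave p" by blast
qed fact+


section \<open>Evaluating independence polynomials by deleting vertices\<close>

text \<open>
  The value at \<open>z\<close> of the independence polynomial of the subgraph induced on \<open>V\<close>. Keeping the arcs
  fixed while \<open>V\<close> shrinks means that no isomorphisms between the graphs left by deletions are needed.
\<close>

definition stable_sum :: "('a \<times> 'a) set \<Rightarrow> 'a set \<Rightarrow> complex \<Rightarrow> complex" where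
  "stable_sum E V z = (\<Sum>S | S \<subseteq> V \<and> pairwise (\<lambda>x y. (x, y) \<notin> E) S. z ^ card S)"

lemma poly_independence_poly:
  assumes fin: "finite (pverts G)"
  shows "poly (map_poly of_real (independence_poly G)) z = stable_sum (parcs G) (pverts G) z"
proof -
  let ?St = "{S. stable_set G S}"
  have finSt: "finite ?St"
    by (rule finite_subset[of _ "Pow (pverts G)"]) (auto simp: stable_set_def fin)
  have "poly (map_poly of_real (independence_poly G)) z =
      (\<Sum>k\<le>stability_number G. of_nat (num_stable_sets G k) * z ^ k)"
  proof -
    have "map_poly of_real (independence_poly G) =
        (\<Sum>k\<le>stability_number G. monom (of_nat (num_stable_sets G k)) k :: complex poly)"
      by (simp add: poly_eq_iff coeff_map_poly independence_poly_def coeff_sum if_distrib cong: if_cong)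
    then show ?thesis by (simp add: poly_sum poly_monom)
  qed
  also have "\<dots> = (\<Sum>k\<le>stability_number G. \<Sum>S | S \<in> ?St \<and> card S = k. z ^ card S)"
    by (intro sum.cong) (auto simp: num_stable_sets_def)
  also have "\<dots> = (\<Sum>S\<in>?St. z ^ card S)"
    by (rule sum.group) (use finSt in \<open>auto simp: stability_number_def\<close>)
  finally show ?thesis by (simp add: stable_set_def stable_sum_def)
qed

lemma stable_sum_empty [simp]: "stable_sum E {} z = 1"
proof -
  have "{S. S \<subseteq> {} \<and> pairwise (\<lambda>x y. (x, y) \<notin> E) S} = {{}}" by auto
  then show ?thesis by (simp add: stable_sum_def)
qed

text \<open>
  A stable set either avoids \<open>v\<close>, or consists of \<open>v\<close> and a stable set of non-neighbours of \<open>v\<close>.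
\<close>

lemma stable_sum_delete:
  assumes "finite V" "v \<in> V" "sym E" "(v, v) \<notin> E"
  shows "stable_sum E V z =
    stable_sum E (V - {v}) z + z * stable_sum E (V - {v} - E `` {v}) z"
proof -
  let ?st = "pairwise (\<lambda>x y. (x, y) \<notin> E)"
  let ?X = "{S. S \<subseteq> V - {v} \<and> ?st S}"
  let ?Y = "{S. S \<subseteq> V - {v} - E `` {v} \<and> ?st S}"
  have fX: "finite ?X" by (rule finite_subset[of _ "Pow V"]) (use assms in auto)
  have fY: "finite ?Y" by (rule finite_subset[of _ "Pow V"]) (use assms in auto)
  have "{S. S \<subseteq> V \<and> ?st S} = ?X \<union> insert v ` ?Y"
  proof (intro equalityI subsetI)
    fix S assume S: "S \<in> {S. S \<subseteq> V \<and> ?st S}"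
    show "S \<in> ?X \<union> insert v ` ?Y"
    proof (cases "v \<in> S")
      case True
      have "S - {v} \<in> ?Y" using S True by (auto simp: pairwise_def)
      moreover have "S = insert v (S - {v})" using True by auto
      ultimately show ?thesis by blast
    qed (use S in auto)
  next
    fix S assume "S \<in> ?X \<union> insert v ` ?Y"
    then show "S \<in> {S. S \<subseteq> V \<and> ?st S}"
      using assms(2,3) by (fastforce simp: pairwise_insert dest: symD)
  qed
  moreover have "?X \<inter> insert v ` ?Y = {}" by auto
  ultimately have "stable_sum E V z =
      (\<Sum>S\<in>?X. z ^ card S) + (\<Sum>S\<in>insert v ` ?Y. z ^ card S)"
    unfolding stable_sum_def using fX fY by (simp add: sum.union_disjoint)
  also have "(\<Sum>S\<in>insert v ` ?Y. z ^ card S) = (\<Sum>S\<in>?Y. z ^ card (insert v S))"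
    by (rule sum.reindex_cong[of "insert v"]) (auto intro!: inj_onI)
  also have "\<dots> = (\<Sum>S\<in>?Y. z * z ^ card S)"
  proof (rule sum.cong)
    fix S assume S: "S \<in> ?Y"
    then have "finite S" using assms(1) by (auto intro: finite_subset)
    with S have "card (insert v S) = Suc (card S)" by (intro card_insert_disjoint) auto
    then show "z ^ card (insert v S) = z * z ^ card S" by simp
  qed simp
  finally show ?thesis by (simp add: stable_sum_def sum_distrib_left)
qed

lemma stable_sum_isolated:
  assumes "finite R" "l \<notin> R" "sym E" "E `` {l} \<inter> insert l R = {}"
  shows "stable_sum E (insert l R) z = (1 + z) * stable_sum E R z"
proof -
  have "insert l R - {l} = R" "R - E `` {l} = R" using assms by auto
  moreover have "(l, l) \<notin> E" using assms by auto
  ultimately show ?thesis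
    using stable_sum_delete[of "insert l R" l E z] assms(1,3) by (simp add: algebra_simps)
qed

text \<open>
  The vertex \<open>l\<close> is a leaf at \<open>v\<close>: it becomes isolated when \<open>v\<close> is left out, and is excluded when
  \<open>v\<close> is chosen.
\<close>

lemma stable_sum_pendant:
  assumes "finite R" "v \<notin> R" "l \<notin> R" "v \<noteq> l" "sym E" "(v, v) \<notin> E" "(v, l) \<in> E"
    and "E `` {l} \<inter> insert l R = {}"
  shows "stable_sum E (insert v (insert l R)) z =
    (1 + z) * stable_sum E R z + z * stable_sum E (R - E `` {v}) z"
proof -
  have "insert v (insert l R) - {v} = insert l R"
    "insert v (insert l R) - {v} - E `` {v} = R - E `` {v}" using assms by auto
  with stable_sum_delete[of "insert v (insert l R)" v E z] stable_sum_isolated[of R l E z] assms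
  show ?thesis by simp
qed

text \<open>
  The source of the recurrence for centipedes. The vertices \<open>v\<close> and \<open>v'\<close> are the last two of the
  spine, with leaves \<open>l\<close> and \<open>l'\<close>; only \<open>v'\<close> may have neighbours in \<open>R\<close>. Choosing \<open>v\<close> excludes
  \<open>v'\<close>, which leaves \<open>l'\<close> isolated and \<open>R\<close> intact, however \<open>v'\<close> is attached to \<open>R\<close>.
\<close>

lemma stable_sum_two_rungs:
  assumes "finite R" "sym E" "distinct [v, l, v', l']" "{v, l, v', l'} \<inter> R = {}"
    and "E `` {l} \<inter> ({l, v', l'} \<union> R) = {}" "E `` {l'} \<inter> ({l'} \<union> R) = {}"
    and "E `` {v} \<inter> ({v, l'} \<union> R) = {}" "(v, l) \<in> E" "(v, v') \<in> E"
  shows "stable_sum E ({v, l, v', l'} \<union> R) z =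
    (1 + z) * stable_sum E ({v', l'} \<union> R) z + z * (1 + z) * stable_sum E R z"
proof -
  have diff: "({v', l'} \<union> R) - E `` {v} = insert l' R" using assms(4,7,9) by blast
  have loop: "(v, v) \<notin> E" using assms(7) by blast
  have "stable_sum E (insert v (insert l ({v', l'} \<union> R))) z =
    (1 + z) * stable_sum E ({v', l'} \<union> R) z + z * stable_sum E (({v', l'} \<union> R) - E `` {v}) z"
    by (rule stable_sum_pendant) (use assms(1-5,8) loop in \<open>auto simp del: Image_singleton_iff\<close>)
  moreover have "stable_sum E (insert l' R) z = (1 + z) * stable_sum E R z"
    by (rule stable_sum_isolated) (use assms(1,2,4,6) in \<open>auto simp del: Image_singleton_iff\<close>)
  ultimately show ?thesis unfolding diff by (simp add: mult.assoc)
qed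


section \<open>A cone preserved by the centipede recurrence\<close>

definition rung_recurrence :: "complex \<Rightarrow> (nat \<Rightarrow> complex) \<Rightarrow> bool" where
  "rung_recurrence z f \<longleftrightarrow> (\<forall>k. f (Suc (Suc k)) = (1 + z) * f (Suc k) + z * (1 + z) * f k)"

definition ratio_cone :: "complex \<Rightarrow> complex set" where
  "ratio_cone z = {of_real a * (1 + z) + of_real b * z | a b. a \<ge> 0 \<and> b \<ge> 0 \<and> a + b > 0}"

text \<open>
  Both generators have the imaginary part of \<open>z\<close>, so no non-trivial combination of them is real.
\<close>

lemma ratio_cone_nonzero:
  assumes "z \<notin> \<real>" "w \<in> ratio_cone z"
  shows "w \<noteq> 0"
proof -
  obtain a b where w: "w = of_real a * (1 + z) + of_real b * z" and ab: "a + b > 0"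
    using assms(2) by (auto simp: ratio_cone_def)
  have "Im w = (a + b) * Im z" by (simp add: w algebra_simps)
  moreover have "Im z \<noteq> 0" using assms(1) by (simp add: complex_is_Real_iff)
  ultimately have "Im w \<noteq> 0" using ab by simp
  then show ?thesis by auto
qed

text \<open>
  Since \<open>1 / w\<close> is a positive multiple of the conjugate of \<open>w\<close>, the number \<open>z (1 + z) / w\<close> is one of
  \<open>z (1 + z) (a (1 + z)\<^sup>* + b z\<^sup>*) = a |1 + z|\<^sup>2 z + b |z|\<^sup>2 (1 + z)\<close>, where the star denotes
  conjugation. This lies in the cone up to its apex; adding the generator \<open>1 + z\<close> avoids the apex.
\<close>

lemma ratio_cone_step:
  assumes z: "z \<notin> \<real>" and w: "w \<in> ratio_cone z"
  shows "(1 + z) + z * (1 + z) / w \<in> ratio_cone z"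
proof -
  obtain a b where w_eq: "w = of_real a * (1 + z) + of_real b * z" and ab: "a \<ge> 0" "b \<ge> 0"
    using w by (auto simp: ratio_cone_def)
  define N where "N = (cmod w)\<^sup>2"
  have "N > 0" using ratio_cone_nonzero[OF z w] by (simp add: N_def)
  have "z * (1 + z) / w = z * (1 + z) * cnj w / of_real N"
    by (simp add: N_def complex_div_cnj [of _ w])
  also have "z * (1 + z) * cnj w =
      of_real a * ((1 + z) * cnj (1 + z)) * z + of_real b * (z * cnj z) * (1 + z)"
    by (simp add: w_eq algebra_simps)
  also have "\<dots> = of_real (a * (cmod (1 + z))\<^sup>2) * z + of_real (b * (cmod z)\<^sup>2) * (1 + z)"
    by (simp only: complex_norm_square [symmetric] of_real_mult)
  finally have "(1 + z) + z * (1 + z) / w =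
      of_real (1 + b * (cmod z)\<^sup>2 / N) * (1 + z) + of_real (a * (cmod (1 + z))\<^sup>2 / N) * z"
    by (simp add: add_divide_distrib algebra_simps)
  moreover have "b * (cmod z)\<^sup>2 / N \<ge> 0" "a * (cmod (1 + z))\<^sup>2 / N \<ge> 0"
    using ab \<open>N > 0\<close> by simp_all
  ultimately show ?thesis
    unfolding ratio_cone_def mem_Collect_eq
    by (intro exI[of _ "1 + b * (cmod z)\<^sup>2 / N"] exI[of _ "a * (cmod (1 + z))\<^sup>2 / N"]) auto
qed

lemma ratio_cone_add:
  assumes "w \<in> ratio_cone z"
  shows "w + z \<in> ratio_cone z"
proof -
  obtain a b where w: "w = of_real a * (1 + z) + of_real b * z" and ab: "a \<ge> 0" "b \<ge> 0"
    using assms by (auto simp: ratio_cone_def)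
  have "w + z = of_real a * (1 + z) + of_real (b + 1) * z" by (simp add: w algebra_simps)
  then show ?thesis
    unfolding ratio_cone_def mem_Collect_eq using ab by (intro exI[of _ a] exI[of _ "b + 1"]) auto
qed

text \<open>
  Both claims are needed together: non-vanishing of \<open>f k\<close> makes the ratio meaningful, and its
  membership in the cone gives non-vanishing of the next value.
\<close>

lemma rung_recurrence_ratio:
  assumes z: "z \<notin> \<real>" and rec: "rung_recurrence z f"
    and f0: "f 0 \<noteq> 0" and f1: "f 1 / f 0 \<in> ratio_cone z"
  shows "f k \<noteq> 0 \<and> f (Suc k) / f k \<in> ratio_cone z"
proof (induction k)
  case 0
  then show ?case using f0 f1 by simp
next
  case (Suc k)
  have nz: "f (Suc k) \<noteq> 0" using ratio_cone_nonzero[OF z] Suc.IH by fastforce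
  have "f (Suc (Suc k)) / f (Suc k) = (1 + z) + z * (1 + z) / (f (Suc k) / f k)"
    using rec nz Suc.IH by (simp add: rung_recurrence_def field_simps)
  with ratio_cone_step[OF z] Suc.IH nz show ?case by metis
qed


section \<open>The two glued centipedes\<close>

abbreviation arcs_join ::
  "nat \<Rightarrow> nat \<Rightarrow>
    ((centipede_vertex + centipede_vertex) \<times> (centipede_vertex + centipede_vertex)) set" where
  "arcs_join m n \<equiv> parcs (joined_centipedes m n)"

text \<open>
  The start \<open>i\<close> varies because choosing \<open>v\<^sub>2\<close> cuts the first two rungs off the first centipede.
\<close>

definition left_segment :: "nat \<Rightarrow> nat \<Rightarrow> (centipede_vertex + centipede_vertex) set" where
  "left_segment i k = Inl ` (A ` {i..<i + k} \<union> B ` {i..<i + k})"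

definition right_segment :: "nat \<Rightarrow> (centipede_vertex + centipede_vertex) set" where
  "right_segment k = Inr ` (A ` {1..k} \<union> B ` {1..k})"

fun centipede_val :: "complex \<Rightarrow> nat \<Rightarrow> complex" where
  "centipede_val z 0 = 1"
| "centipede_val z (Suc 0) = 1 + 2 * z"
| "centipede_val z (Suc (Suc k)) =
     (1 + z) * centipede_val z (Suc k) + z * (1 + z) * centipede_val z k"

text \<open>
  The value of \<open>I(G\<^bsub>m,k\<^esub>; z)\<close> for \<open>k \<ge> 2\<close>. For \<open>k = 1\<close> the joining edge is absent, and the value is that
  of the disjoint union of \<open>W\<^sub>m\<close> and one edge. For \<open>k = 0\<close> the value does not come from the graph: it is
  chosen so that the recurrence already produces \<open>k = 2\<close>.
\<close>

fun joined_val :: "complex \<Rightarrow> nat \<Rightarrow> nat \<Rightarrow> complex" where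
  "joined_val z m 0 = (1 + 2 * z) * ((1 + z) * centipede_val z (m - 2))"
| "joined_val z m (Suc 0) = (1 + 2 * z) * centipede_val z m"
| "joined_val z m (Suc (Suc k)) =
     (1 + z) * joined_val z m (Suc k) + z * (1 + z) * joined_val z m k"

lemma centipede_val_ratio:
  assumes "z \<notin> \<real>"
  shows "centipede_val z k \<noteq> 0 \<and> centipede_val z (Suc k) / centipede_val z k \<in> ratio_cone z"
proof (rule rung_recurrence_ratio[OF assms])
  show "centipede_val z 1 / centipede_val z 0 \<in> ratio_cone z"
    unfolding ratio_cone_def mem_Collect_eq by (intro exI[of _ 1]) simp
qed (auto simp: rung_recurrence_def)

text \<open>
  The ratio of the two starting values is \<open>w\<^sub>m / ((1 + z) w\<^bsub>m-2\<^esub>)\<close>, which by the recurrence for \<open>w\<close>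
  equals \<open>w\<^bsub>m-1\<^esub> / w\<^bsub>m-2\<^esub> + z\<close>.
\<close>

lemma joined_val_nonzero:
  assumes z: "z \<notin> \<real>" and "m \<ge> 2"
  shows "joined_val z m n \<noteq> 0"
proof -
  define k where "k = m - 2"
  have m: "m = Suc (Suc k)" using \<open>m \<ge> 2\<close> by (simp add: k_def)
  have nz: "1 + z \<noteq> 0" "1 + 2 * z \<noteq> 0"
    using z by (auto simp: complex_is_Real_iff complex_eq_iff)
  note k = centipede_val_ratio[OF z, of k]
  show ?thesis
  proof (rule rung_recurrence_ratio[OF z, THEN conjunct1])
    show "rung_recurrence z (joined_val z m)" by (auto simp: rung_recurrence_def)
    show "joined_val z m 0 \<noteq> 0" using k nz by (simp add: m)
    have "joined_val z m 1 / joined_val z m 0 =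
        centipede_val z (Suc k) / centipede_val z k + z"
      using nz k by (simp add: m divide_simps) (simp add: algebra_simps)
    then show "joined_val z m 1 / joined_val z m 0 \<in> ratio_cone z"
      using ratio_cone_add k by simp
  qed
qed

lemma sym_arcs_join: "sym (arcs_join m n)"
  by (rule symI) (auto simp: joined_centipedes_def edge_join_def centipede_def)

lemma arcs_join_iff:
  "(Inl (A i), y) \<in> arcs_join m n \<longleftrightarrow> 1 \<le> i \<and> i \<le> m \<and> y = Inl (B i)"
  "(Inr (A i), y) \<in> arcs_join m n \<longleftrightarrow> 1 \<le> i \<and> i \<le> n \<and> y = Inr (B i)"
  "(Inl (B i), y) \<in> arcs_join m n \<longleftrightarrow>
     1 \<le> i \<and> i \<le> m \<and> y = Inl (A i) \<or>
     (\<exists>j. y = Inl (B j) \<and> 1 \<le> i \<and> 1 \<le> j \<and> i \<le> m \<and> j \<le> m \<and> (j = Suc i \<or> i = Suc j)) \<or>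
     i = 2 \<and> y = Inr (B 2)"
  "(Inr (B i), y) \<in> arcs_join m n \<longleftrightarrow>
     1 \<le> i \<and> i \<le> n \<and> y = Inr (A i) \<or>
     (\<exists>j. y = Inr (B j) \<and> 1 \<le> i \<and> 1 \<le> j \<and> i \<le> n \<and> j \<le> n \<and> (j = Suc i \<or> i = Suc j)) \<or>
     i = 2 \<and> y = Inl (B 2)"
proof -
  have *: "(Inl x, Inl y) \<in> arcs_join m n \<longleftrightarrow> (x, y) \<in> parcs (centipede m)"
    "(Inr x, Inr y) \<in> arcs_join m n \<longleftrightarrow> (x, y) \<in> parcs (centipede n)"
    "(Inl x, Inr y) \<in> arcs_join m n \<longleftrightarrow> x = B 2 \<and> y = B 2"
    "(Inr x, Inl y) \<in> arcs_join m n \<longleftrightarrow> x = B 2 \<and> y = B 2" for x y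
    by (auto simp: joined_centipedes_def edge_join_def intro: map_prod_imageI)
  have **: "(A i, y) \<in> parcs (centipede k) \<longleftrightarrow> 1 \<le> i \<and> i \<le> k \<and> y = B i"
    "(B i, y) \<in> parcs (centipede k) \<longleftrightarrow> 1 \<le> i \<and> i \<le> k \<and> y = A i \<or>
     (\<exists>j. y = B j \<and> 1 \<le> i \<and> 1 \<le> j \<and> i \<le> k \<and> j \<le> k \<and> (j = Suc i \<or> i = Suc j))" for y k
    by (auto simp: centipede_def centipede_edges_def)
  show "(Inl (A i), y) \<in> arcs_join m n \<longleftrightarrow> 1 \<le> i \<and> i \<le> m \<and> y = Inl (B i)"
    by (cases y) (simp_all add: * **)
  show "(Inr (A i), y) \<in> arcs_join m n \<longleftrightarrow> 1 \<le> i \<and> i \<le> n \<and> y = Inr (B i)"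
    by (cases y) (simp_all add: * **)
  show "(Inl (B i), y) \<in> arcs_join m n \<longleftrightarrow>
     1 \<le> i \<and> i \<le> m \<and> y = Inl (A i) \<or>
     (\<exists>j. y = Inl (B j) \<and> 1 \<le> i \<and> 1 \<le> j \<and> i \<le> m \<and> j \<le> m \<and> (j = Suc i \<or> i = Suc j)) \<or>
     i = 2 \<and> y = Inr (B 2)"
    by (cases y) (simp_all add: * **)
  show "(Inr (B i), y) \<in> arcs_join m n \<longleftrightarrow>
     1 \<le> i \<and> i \<le> n \<and> y = Inr (A i) \<or>
     (\<exists>j. y = Inr (B j) \<and> 1 \<le> i \<and> 1 \<le> j \<and> i \<le> n \<and> j \<le> n \<and> (j = Suc i \<or> i = Suc j)) \<or>
     i = 2 \<and> y = Inl (B 2)"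
    by (cases y) (simp_all add: * **)
qed

lemma mem_segment [simp]:
  "Inl (A j) \<in> left_segment i k \<longleftrightarrow> i \<le> j \<and> j < i + k"
  "Inl (B j) \<in> left_segment i k \<longleftrightarrow> i \<le> j \<and> j < i + k"
  "Inr x \<notin> left_segment i k"
  "Inr (A j) \<in> right_segment k \<longleftrightarrow> 1 \<le> j \<and> j \<le> k"
  "Inr (B j) \<in> right_segment k \<longleftrightarrow> 1 \<le> j \<and> j \<le> k"
  "Inl x \<notin> right_segment k"
  by (auto simp: left_segment_def right_segment_def)

lemma finite_segment [simp]: "finite (left_segment i k)" "finite (right_segment k)"
  by (simp_all add: left_segment_def right_segment_def)

lemma left_segment_0 [simp]: "left_segment i 0 = {}"
  by (simp add: left_segment_def)

lemma right_segment_0 [simp]: "right_segment 0 = {}"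
  by (simp add: right_segment_def)

lemma left_segment_Suc:
  "left_segment i (Suc k) = {Inl (B (i + k)), Inl (A (i + k))} \<union> left_segment i k"
  by (auto simp: left_segment_def)

lemma right_segment_Suc:
  "right_segment (Suc k) = {Inr (B (Suc k)), Inr (A (Suc k))} \<union> right_segment k"
  by (auto simp: right_segment_def atLeastAtMostSuc_conv)

lemma left_segment_drop2:
  "left_segment i (Suc (Suc k)) =
    {Inl (A i), Inl (B i), Inl (A (Suc i)), Inl (B (Suc i))} \<union> left_segment (Suc (Suc i)) k"
proof -
  have "{i..<i + Suc (Suc k)} = insert i (insert (Suc i) {Suc (Suc i)..<Suc (Suc i) + k})" by auto
  then show ?thesis by (auto simp: left_segment_def)
qed

lemma stable_sum_left_segment:
  assumes "1 \<le> i" "i + k \<le> Suc m"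
  shows "stable_sum (arcs_join m n) (left_segment i k) z = centipede_val z k"
  using assms(2)
proof (induction k rule: induct_nat_012[case_names zero one step])
  case zero
  then show ?case by simp
next
  case one
  have "stable_sum (arcs_join m n) (insert (Inl (B i)) (insert (Inl (A i)) {})) z =
    (1 + z) * stable_sum (arcs_join m n) {} z +
    z * stable_sum (arcs_join m n) ({} - arcs_join m n `` {Inl (B i)}) z"
    by (rule stable_sum_pendant) (use assms(1) one in \<open>auto simp: sym_arcs_join arcs_join_iff\<close>)
  then show ?case by (simp add: left_segment_Suc)
next
  case (step k)
  have "stable_sum (arcs_join m n) ({Inl (B (i + Suc k)), Inl (A (i + Suc k)), Inl (B (i + k)), Inl (A (i + k))}
        \<union> left_segment i k) z =
    (1 + z) * stable_sum (arcs_join m n) ({Inl (B (i + k)), Inl (A (i + k))} \<union> left_segment i k) z +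
    z * (1 + z) * stable_sum (arcs_join m n) (left_segment i k) z"
    by (rule stable_sum_two_rungs)
      (use assms(1) step.prems in \<open>auto simp: sym_arcs_join arcs_join_iff\<close>)
  moreover have "left_segment i (Suc (Suc k)) =
    {Inl (B (i + Suc k)), Inl (A (i + Suc k)), Inl (B (i + k)), Inl (A (i + k))} \<union> left_segment i k"
    by (auto simp: left_segment_Suc)
  ultimately show ?case using step by (simp add: left_segment_Suc)
qed

text \<open>
  From the third rung on, the last spine vertex is away from the joining edge. The last but one may
  be \<open>v\<^sub>2\<close>, and \<open>stable_sum_two_rungs\<close> allows it the neighbour \<open>b\<^sub>2\<close>. The second rung carries the joining
  edge itself and needs a separate computation.
\<close>

lemma stable_sum_joined:
  assumes m: "m \<ge> 2" and "1 \<le> k" "k \<le> n"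
  shows "stable_sum (arcs_join m n) (right_segment k \<union> left_segment 1 m) z = joined_val z m k"
proof -
  let ?E = "arcs_join m n" and ?L = "left_segment 1 m"
  have L: "stable_sum ?E ?L z = centipede_val z m"
    by (rule stable_sum_left_segment) auto
  have one: "stable_sum ?E (right_segment 1 \<union> ?L) z = joined_val z m 1" if "1 \<le> n"
  proof -
    have "stable_sum ?E (insert (Inr (B 1)) (insert (Inr (A 1)) ?L)) z =
      (1 + z) * stable_sum ?E ?L z + z * stable_sum ?E (?L - ?E `` {Inr (B 1)}) z"
      by (rule stable_sum_pendant) (use that in \<open>auto simp: sym_arcs_join arcs_join_iff\<close>)
    moreover have "?L - ?E `` {Inr (B 1)} = ?L" by (auto simp: arcs_join_iff)
    ultimately show ?thesis using L by (simp add: right_segment_Suc algebra_simps)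
  qed
  have two: "stable_sum ?E (right_segment 2 \<union> ?L) z = joined_val z m 2" if "2 \<le> n"
  proof -
    let ?T = "left_segment 3 (m - 2)"
    have m': "m = Suc (Suc (m - 2))" using m by simp
    have L_eq: "?L = {Inl (A 1), Inl (B 1), Inl (A 2), Inl (B 2)} \<union> ?T"
      using left_segment_drop2[of 1 "m - 2"] unfolding m'[symmetric]
      by (simp add: eval_nat_numeral)
    let ?R1 = "insert (Inr (B 1)) (insert (Inr (A 1)) ?L)"
    let ?P = "insert (Inl (B 1)) (insert (Inl (A 1)) ?T)"
    have "stable_sum ?E (insert (Inr (B 2)) (insert (Inr (A 2)) ?R1)) z =
      (1 + z) * stable_sum ?E ?R1 z + z * stable_sum ?E (?R1 - ?E `` {Inr (B 2)}) z"
      by (rule stable_sum_pendant) (use that in \<open>auto simp: sym_arcs_join arcs_join_iff\<close>)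
    moreover have "insert (Inr (B 2)) (insert (Inr (A 2)) ?R1) = right_segment 2 \<union> ?L"
      by (auto simp: right_segment_Suc numeral_2_eq_2)
    moreover have "?R1 = right_segment 1 \<union> ?L" by (auto simp: right_segment_Suc)
    (* Choosing v_2 excludes v_1 and b_2. *)
    moreover have "?R1 - ?E `` {Inr (B 2)} = insert (Inr (A 1)) (insert (Inl (A 2)) ?P)"
      unfolding L_eq using that by (auto simp: arcs_join_iff)
    moreover have "stable_sum ?E (insert (Inr (A 1)) (insert (Inl (A 2)) ?P)) z =
        (1 + z) * stable_sum ?E (insert (Inl (A 2)) ?P) z"
      by (rule stable_sum_isolated) (auto simp: sym_arcs_join arcs_join_iff)
    moreover have "stable_sum ?E (insert (Inl (A 2)) ?P) z = (1 + z) * stable_sum ?E ?P z"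
      by (rule stable_sum_isolated) (auto simp: sym_arcs_join arcs_join_iff)
    moreover have "stable_sum ?E ?P z =
        (1 + z) * stable_sum ?E ?T z + z * stable_sum ?E (?T - ?E `` {Inl (B 1)}) z"
      by (rule stable_sum_pendant) (use m in \<open>auto simp: sym_arcs_join arcs_join_iff\<close>)
    moreover have "?T - ?E `` {Inl (B 1)} = ?T" by (auto simp: arcs_join_iff)
    moreover have "stable_sum ?E ?T z = centipede_val z (m - 2)"
      by (rule stable_sum_left_segment) (use m in auto)
    ultimately show ?thesis using one that by (simp add: numeral_2_eq_2 algebra_simps)
  qed
  show ?thesis
    using assms(2,3)
  proof (induction k rule: less_induct)
    case (less k)
    consider "k = 1" | "k = 2" | "3 \<le> k" using less.prems(1) by linarith
    then show ?case
    proof cases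
      case 1
      then show ?thesis using one less.prems by simp
    next
      case 2
      then show ?thesis using two less.prems by simp
    next
      case ge3: 3
      define j where "j = k - 3"
      have 3: "k = Suc (Suc (Suc j))" using ge3 by (simp add: j_def)
      let ?q = "Suc (Suc j)"
      let ?R = "right_segment (Suc j) \<union> ?L"
      have "stable_sum ?E ({Inr (B (Suc ?q)), Inr (A (Suc ?q)), Inr (B ?q), Inr (A ?q)} \<union> ?R) z =
        (1 + z) * stable_sum ?E ({Inr (B ?q), Inr (A ?q)} \<union> ?R) z + z * (1 + z) * stable_sum ?E ?R z"
        by (rule stable_sum_two_rungs)
          (use less.prems 3 in \<open>auto simp: sym_arcs_join arcs_join_iff\<close>)
      moreover have "{Inr (B (Suc ?q)), Inr (A (Suc ?q)), Inr (B ?q), Inr (A ?q)} \<union> ?R =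
          right_segment k \<union> ?L" and "{Inr (B ?q), Inr (A ?q)} \<union> ?R = right_segment ?q \<union> ?L"
        by (auto simp: 3 right_segment_Suc)
      ultimately show ?thesis using less.IH[of ?q] less.IH[of "Suc j"] less.prems 3 by simp
    qed
  qed
qed

lemma pverts_joined_centipedes:
  "pverts (joined_centipedes m n) = right_segment n \<union> left_segment 1 m"
  by (auto simp: joined_centipedes_def edge_join_def centipede_def left_segment_def right_segment_def)

theorem theorem4p5:
  fixes m n :: nat
  assumes "m \<ge> 2" and "n \<ge> 2"
  shows "unimodal (independence_poly (joined_centipedes m n))"
proof (rule unimodal_if_real_rooted)
  let ?p = "independence_poly (joined_centipedes m n)"
  have eval: "poly (map_poly of_real ?p) z = joined_val z m n" for z
    using poly_independence_poly[of "joined_centipedes m n" z] stable_sum_joined[of m n n z] assms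
    by (simp add: pverts_joined_centipedes)
  show "z \<in> \<real>" if "poly (map_poly complex_of_real ?p) z = 0" for z
    using joined_val_nonzero[of z m n] that assms(1) by (auto simp: eval)
  (* Any non-real point would do to show that the polynomial is not zero. *)
  show "?p \<noteq> 0"
    using joined_val_nonzero[of \<i> m n] assms(1) eval[of \<i>] by (auto simp: complex_is_Real_iff)
  show "coeff ?p i \<ge> 0" for i
    by (simp add: independence_poly_def coeff_sum sum_nonneg)
qed

end
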